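(* Let $\{\mathcal{H}_k\}_{k\geqslant1}$ be any concave increasing sequence of real numbers and let $n$, $T$ be integers with $0\leqslant n\leqslant T-1$ and $T\geqslant3$. Then $$\sum_{s=1}^{T-1}(-1)^{s+1}R_n(s,T)\,\mathcal{H}_s<\sum_{s=1}^{T-1}\mathcal{H}_s.$$
   Context: A sequence $\{\mathcal{H}_k\}_{k\geqslant1}$ of positive real numbers (with the convention $\mathcal{H}_0=0$) is called concave increasing if $\mathcal{H}_k=\sum_{i=1}^kh_i$ for some monotone decreasing sequence $h_1\geqslant h_2\geqslant\cdots$ of positive reals. For integers $T\geqslant 1$ and $0\leqslant n,s\leqslant T-1$, $R_n(s,T)$ is the Racah polynomial value $$R_n(s,T)={}_4F_3\left(\begin{matrix}-n,\ n+1,\ -s,\ s+1\\ 1,\ 1+T,\ 1-T\end{matrix}\,\middle|\,1\right)=\sum_{j=0}^{\min(n,s)}\frac{(-n)_j(n+1)_j(-s)_j(s+1)_j}{(j!)^2(1+T)_j(1-T)_j},$$ where $(a)_j=a(a+1)\cdots(a+j-1)$. *)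

theory Defs
  imports Complex_Main
begin

text \<open>
  The sequence is a function on \<open>nat\<close> whose value at \<open>0\<close> is \<open>0\<close> (the empty sum);
  \<open>h 0\<close> is irrelevant. The values \<open>H k\<close>, \<open>k \<ge> 1\<close>, are automatically positive.
\<close>
definition concave_increasing :: "(nat \<Rightarrow> real) \<Rightarrow> bool" where
  "concave_increasing H \<longleftrightarrow>
     (\<exists>h :: nat \<Rightarrow> real. (\<forall>i\<ge>1. 0 < h i) \<and> antimono_on {1..} h \<and>
        (\<forall>k. H k = (\<Sum>i=1..k. h i)))"

text \<open>
  The terminating series \<open>4F3(-n, n+1, -s, s+1; 1, 1+T, 1-T | 1)\<close>, whose terms vanish for
  \<open>j > min n s\<close>. For \<open>n, s \<le> T - 1\<close> no denominator in the range of summation is zero,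
  although the lower parameter \<open>1 - T\<close> is a non-positive integer.
\<close>
definition racah :: "nat \<Rightarrow> nat \<Rightarrow> nat \<Rightarrow> real" where
  "racah n s T =
     (\<Sum>j=0..min n s.
        (pochhammer (- real n) j * pochhammer (real n + 1) j *
         pochhammer (- real s) j * pochhammer (real s + 1) j) /
        ((fact j)\<^sup>2 * pochhammer (1 + real T) j * pochhammer (1 - real T) j))"

end

theory Submission
  imports Defs
begin

text \<open>
  The inequality holds term by term: \<open>\<bar>R\<^sub>n(s,T)\<bar> \<le> 1\<close> for all \<open>n, s < T\<close>
  (\<open>abs_racah_le_1\<close>), and one term is strictly smaller, namely the one for \<open>s = 1\<close> if
  \<open>n \<ge> 1\<close> and the one for \<open>s = 2\<close>, which has a negative sign, if \<open>n = 0\<close>.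

  The bound on \<open>R\<^sub>n(s,T)\<close> comes from a stochastic interpretation. Put \<open>N = T - 1\<close>. Up to a
  constant factor, \<open>R\<^sub>n(s,T)\<close> is an eigenvalue of a nonnegative matrix on \<open>{0..N}\<close> with
  constant row sums, and such an eigenvalue is at most the row sum in absolute value
  (\<open>transition_kernel_eigenvalue_le\<close>). The matrix comes from angular momentum theory. Let the
  Lie algebra sl2 act on its irreducible module of dimension \<open>T\<close>. The matrices of size \<open>T\<close>
  contain one irreducible submodule of dimension \<open>2s + 1\<close> for each \<open>s \<le> N\<close>, with a weight basis
  \<open>X\<^sub>0, \<dots>, X\<^bsub>2s\<^esub>\<close> (\<open>tensor_op\<close>). After
  normalization of this basis, the map sending a matrix \<open>Y\<close> to the sum of the
  \<open>X\<^sub>r Y X\<^sub>r\<^sup>*\<close> commutes with the action. On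
  diagonal matrices the entries of this map are weighted sums of the squares of the entries of
  the \<open>X\<^sub>r\<close>, hence nonnegative; they are squared Clebsch-Gordan coefficients up to
  normalization.

  Invariance is used in one elementary consequence: the kernel commutes with the Casimir
  operator, which on diagonal matrices is a second-order difference operator
  (\<open>transition_kernel_laplacian_commute\<close>). The eigenvectors of that operator are the discrete
  Chebyshev polynomials (\<open>discrete_chebyshev_eigenvector\<close>), and since an eigenvector is
  determined by its value at \<open>0\<close>, they are eigenvectors of the kernel as well. The eigenvalue can
  be read off from row \<open>0\<close> of the kernel. This row has closed-form entries, and its moments
  follow from the Chu-Vandermonde identity. Inserting them into the discrete Chebyshev
  polynomial of degree \<open>n\<close> yields exactly the \<open>4F3\<close> series of \<open>R\<^sub>n(s,T)\<close>
  (\<open>transition_kernel_chebyshev\<close>).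
\<close>

section \<open>Commutators with the ladder matrices of sl2\<close>

text \<open>
  Products of a matrix with the raising matrix \<open>E\<close> with entries
  \<open>E\<^bsub>i,i+1\<^esub> = N - i\<close>, and the lowering matrix \<open>F\<close> with entries
  \<open>F\<^bsub>i,i-1\<^esub> = i\<close>, both zero elsewhere. The index range is all of \<open>nat\<close>; the block \<open>{0..N}\<close>
  carries the irreducible module of dimension \<open>N + 1\<close>. Working without truncation spares the
  boundary case at \<open>N\<close> in the commutation relations, and this unnormalized form of the module
  avoids square roots.
\<close>

definition raise_left :: "nat \<Rightarrow> (nat \<Rightarrow> nat \<Rightarrow> real) \<Rightarrow> nat \<Rightarrow> nat \<Rightarrow> real" where
  "raise_left N X i k = (real N - real i) * X (Suc i) k"

definition raise_right :: "nat \<Rightarrow> (nat \<Rightarrow> nat \<Rightarrow> real) \<Rightarrow> nat \<Rightarrow> nat \<Rightarrow> real" where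
  "raise_right N X i k = (case k of 0 \<Rightarrow> 0 | Suc l \<Rightarrow> (real N - real l) * X i l)"

definition lower_left :: "(nat \<Rightarrow> nat \<Rightarrow> real) \<Rightarrow> nat \<Rightarrow> nat \<Rightarrow> real" where
  "lower_left X i k = real i * X (i - 1) k"

definition lower_right :: "(nat \<Rightarrow> nat \<Rightarrow> real) \<Rightarrow> nat \<Rightarrow> nat \<Rightarrow> real" where
  "lower_right X i k = real (Suc k) * X i (Suc k)"

definition ad_raise :: "nat \<Rightarrow> (nat \<Rightarrow> nat \<Rightarrow> real) \<Rightarrow> nat \<Rightarrow> nat \<Rightarrow> real" where
  "ad_raise N X i k = raise_left N X i k - raise_right N X i k"

definition ad_lower :: "(nat \<Rightarrow> nat \<Rightarrow> real) \<Rightarrow> nat \<Rightarrow> nat \<Rightarrow> real" where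
  "ad_lower X i k = lower_left X i k - lower_right X i k"

definition anti_raise :: "nat \<Rightarrow> (nat \<Rightarrow> nat \<Rightarrow> real) \<Rightarrow> nat \<Rightarrow> nat \<Rightarrow> real" where
  "anti_raise N X i k = raise_left N X i k + raise_right N X i k"

definition anti_lower :: "(nat \<Rightarrow> nat \<Rightarrow> real) \<Rightarrow> nat \<Rightarrow> nat \<Rightarrow> real" where
  "anti_lower X i k = lower_left X i k + lower_right X i k"

lemmas ladder_defs = raise_left_def raise_right_def lower_left_def lower_right_def
  ad_raise_def ad_lower_def anti_raise_def anti_lower_def

text \<open>
  The Jacobi identity for \<open>[E, [F, X]]\<close>: the commutator \<open>[E, F]\<close> is diagonal with entries
  \<open>N - 2i\<close>.
\<close>

lemma ad_raise_ad_lower: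
  "ad_raise N (ad_lower X) i k = ad_lower (ad_raise N X) i k + 2 * (real k - real i) * X i k"
  by (cases i; cases k) (simp_all add: ladder_defs algebra_simps)

text \<open>
  Expanding commutators and anticommutators, the terms in which \<open>X\<close> stands between \<open>E\<close> and
  \<open>F\<close> cancel, and what remains is \<open>(EF + FE)X - X(EF + FE)\<close>, where \<open>EF + FE\<close> is diagonal.
  Differences of squares factor into a commutator and an anticommutator, so this linear
  identity governs how squares of matrix entries transform.
\<close>

lemma anti_casimir:
  "anti_lower (ad_raise N X) i k + anti_raise N (ad_lower X) i k =
     ((real i + 1) * (real N - real i) + real i * (real N - real i + 1)
      - (real k + 1) * (real N - real k) - real k * (real N - real k + 1)) * X i k"
  by (cases i; cases k) (simp_all add: ladder_defs algebra_simps)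

lemma ladder_scale:
  "ad_lower (\<lambda>i k. a * X i k) i k = a * ad_lower X i k"
  "anti_lower (\<lambda>i k. a * X i k) i k = a * anti_lower X i k"
  by (simp_all add: ladder_defs algebra_simps)

section \<open>The irreducible tensor operators\<close>

text \<open>
  The basis of an irreducible space of matrices obtained by lowering its highest weight vector
  \<open>E\<^sup>s\<close>: the \<open>r\<close>-th vector is \<open>[F, [F, \<dots> [F, E\<^sup>s]]]\<close> with \<open>r\<close> brackets.
\<close>

primrec tensor_op :: "nat \<Rightarrow> nat \<Rightarrow> nat \<Rightarrow> nat \<Rightarrow> nat \<Rightarrow> real" where
  "tensor_op N s 0 = (\<lambda>i k. if k = i + s then \<Prod>l<s. real N - real i - real l else 0)"
| "tensor_op N s (Suc r) = ad_lower (tensor_op N s r)"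

lemma tensor_op_support:
  "k + r \<noteq> i + s \<Longrightarrow> tensor_op N s r i k = 0"
proof (induction r arbitrary: i k)
  case (Suc r)
  then show ?case by (cases i) (simp_all add: ladder_defs)
qed simp

text \<open>
  The only entry of \<open>E\<close> or \<open>F\<close> in a row up to \<open>N\<close> and a column beyond \<open>N\<close> that could be
  nonzero is \<open>E\<^bsub>N,N+1\<^esub> = N - N\<close>.
\<close>

lemma tensor_op_outside:
  "i \<le> N \<Longrightarrow> N < k \<Longrightarrow> tensor_op N s r i k = 0"
proof (induction r arbitrary: i k)
  case 0
  have "k = i + s \<Longrightarrow> N - i \<in> {..<s} \<and> real N - real i - real (N - i) = 0"
    using 0 by auto
  then show ?case by (auto intro!: prod_zero bexI[of _ "N - i"])
next
  case (Suc r)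
  then show ?case by (simp add: ladder_defs)
qed

text \<open>
  \<open>E\<close> commutes with its own power \<open>E\<^sup>s\<close>.
\<close>

lemma ad_raise_tensor_op_0: "ad_raise N (tensor_op N s 0) i k = 0"
proof (cases k)
  case 0
  then show ?thesis by (simp add: ladder_defs)
next
  case (Suc l)
  have "(real N - real i) * (\<Prod>q<s. real N - real (Suc i) - real q)
        = (\<Prod>q<Suc s. real N - real i - real q)"
    by (subst prod.lessThan_Suc_shift) (simp add: algebra_simps)
  also have "\<dots> = (\<Prod>q<s. real N - real i - real q) * (real N - real i - real s)"
    by simp
  finally show ?thesis using Suc by (simp add: ladder_defs)
qed

text \<open>
  The standard sl2 computation: moving \<open>ad E\<close> past \<open>ad F\<close> costs the weight \<open>2(s - r)\<close>, and
  these weights add up to \<open>(r + 1)(2s - r)\<close>.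
\<close>

lemma ad_raise_tensor_op_Suc:
  "ad_raise N (tensor_op N s (Suc r)) i k = (real r + 1) * (2 * real s - real r) * tensor_op N s r i k"
proof (induction r arbitrary: i k)
  have weight: "2 * (real k - real i) * tensor_op N s r i k
      = 2 * (real s - real r) * tensor_op N s r i k" for r i k
  proof (cases "k + r = i + s")
    case True
    then have "real k - real i = real s - real r" by linarith
    then show ?thesis by simp
  qed (simp add: tensor_op_support)
  {
    case 0
    have "ad_raise N (tensor_op N s 0) = (\<lambda>i k. 0 * 0)"
      by (intro ext) (simp only: ad_raise_tensor_op_0)
    then have "ad_lower (ad_raise N (tensor_op N s 0)) i k = 0"
      by (simp add: ladder_defs)
    then show ?case using weight[of k i 0]
      by (simp only: tensor_op.simps(2) ad_raise_ad_lower) simp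
  next
    case (Suc r)
    have eq: "ad_raise N (tensor_op N s (Suc r))
        = (\<lambda>i k. (real r + 1) * (2 * real s - real r) * tensor_op N s r i k)"
      by (intro ext) (rule Suc)
    have "ad_raise N (tensor_op N s (Suc (Suc r))) i k
       = ad_lower (ad_raise N (tensor_op N s (Suc r))) i k
         + 2 * (real k - real i) * tensor_op N s (Suc r) i k"
      by (simp only: tensor_op.simps(2) ad_raise_ad_lower)
    also have "\<dots> = (real r + 1) * (2 * real s - real r) * tensor_op N s (Suc r) i k
         + 2 * (real s - real (Suc r)) * tensor_op N s (Suc r) i k"
      unfolding eq ladder_scale weight by simp
    finally show ?case by (simp add: algebra_simps)
  }
qed

text \<open>
  The coefficient \<open>(r + 1)(2s - r)\<close> vanishes at \<open>r = 2s\<close>, so this operator commutes with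
  \<open>E\<close>. It is strictly lower triangular, and the rows up to \<open>N\<close> of a matrix commuting
  with \<open>E\<close> are determined by row \<open>0\<close>.
\<close>

lemma tensor_op_exhausted:
  "i \<le> N \<Longrightarrow> tensor_op N s (Suc (2 * s)) i k = 0"
proof (induction k arbitrary: i)
  let ?Z = "tensor_op N s (Suc (2 * s))"
  have comm: "raise_left N ?Z i k = raise_right N ?Z i k" for i k
    using ad_raise_tensor_op_Suc[of N s "2 * s" i k] by (simp add: ad_raise_def)
  have row0: "?Z 0 k = 0" for k
    by (rule tensor_op_support) simp
  {
    case 0
    then show ?case
      using comm[of "i - 1" 0] row0[of 0]
      by (cases i) (auto simp: raise_left_def raise_right_def simp del: tensor_op.simps)
  next
    case (Suc k)
    show ?case
    proof (cases i)
      case 0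
      then show ?thesis using row0 by simp
    next
      case (Suc j)
      have "?Z j k = 0" using Suc.IH[of j] Suc.prems Suc by simp
      then show ?thesis
        using comm[of j "Suc k"] Suc.prems Suc
        by (auto simp: raise_left_def raise_right_def simp del: tensor_op.simps)
    qed
  }
qed

section \<open>A nonnegative kernel that commutes with the Casimir operator\<close>

text \<open>
  The weights \<open>(2s - r)! / r!\<close> are, up to a constant, the reciprocals of the squared norms of the
  basis vectors \<open>tensor_op N s r\<close> in a unitary structure. Each is the factor
  \<open>(r + 1)(2s - r)\<close>, by which \<open>ad E\<close> undoes \<open>ad F\<close>, times the next one.
\<close>

definition coupling :: "nat \<Rightarrow> nat \<Rightarrow> nat \<Rightarrow> nat \<Rightarrow> real" where
  "coupling N s i k = (\<Sum>r\<le>2*s. fact (2 * s - r) / fact r * (tensor_op N s r i k)\<^sup>2)"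

text \<open>
  The binomial coefficients compensate for the lack of normalization of the basis of the module:
  they are the squared norms of its basis vectors in a unitary structure.
\<close>

definition transition_kernel :: "nat \<Rightarrow> nat \<Rightarrow> nat \<Rightarrow> nat \<Rightarrow> real" where
  "transition_kernel N s i k = real (N choose i) / real (N choose k) * coupling N s i k"

lemma transition_kernel_nonneg: "0 \<le> transition_kernel N s i k"
  unfolding transition_kernel_def coupling_def
  by (intro mult_nonneg_nonneg divide_nonneg_nonneg sum_nonneg) simp_all

text \<open>
  Each difference of squares on the left is a product of a commutator and an anticommutator of
  \<open>X\<^sub>r\<close> with \<open>E\<close> or \<open>F\<close>. The commutators are neighbours of \<open>X\<^sub>r\<close> in the basis. After a
  shift of the summation index, every summand carries a factor \<open>X\<^sub>r\<close>, and its cofactor is the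
  expression evaluated in \<open>anti_casimir\<close>. The weights of \<open>coupling\<close> are those for which the
  shifted sums match, and the shift has no boundary term because the ladder ends on both sides.
\<close>

lemma coupling_intertwine:
  assumes "i \<le> N"
  shows "(real N - real i)\<^sup>2 * coupling N s (Suc i) k + (real i)\<^sup>2 * coupling N s (i - 1) k
       - (real k + 1)\<^sup>2 * coupling N s i (Suc k)
       - (case k of 0 \<Rightarrow> 0 | Suc l \<Rightarrow> (real N - real l)\<^sup>2 * coupling N s i l)
     = ((real i + 1) * (real N - real i) + real i * (real N - real i + 1)
        - (real k + 1) * (real N - real k) - real k * (real N - real k + 1)) * coupling N s i k"
proof -
  define X where "X = tensor_op N s"
  define c :: "nat \<Rightarrow> real" where "c r = fact (2 * s - r) / fact r" for r
  define D where "D = (real i + 1) * (real N - real i) + real i * (real N - real i + 1)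
        - (real k + 1) * (real N - real k) - real k * (real N - real k + 1)"
  have Xs: "X (Suc r) = ad_lower (X r)" for r by (simp add: X_def)
  have Xe: "ad_raise N (X 0) = (\<lambda>i k. 0)"
    "ad_raise N (X (Suc r)) = (\<lambda>i k. (real r + 1) * (2 * real s - real r) * X r i k)" for r
    unfolding X_def by (intro ext, rule ad_raise_tensor_op_0)
      (intro ext, rule ad_raise_tensor_op_Suc)
  have cs: "c (Suc r) * ((real r + 1) * (2 * real s - real r)) = c r" if "r < 2 * s" for r
  proof -
    define m where "m = 2 * s - Suc r"
    have "2 * s - r = Suc m" "2 * real s - real r = real m + 1"
      using that by (auto simp: m_def of_nat_diff)
    then have eqs: "c r = fact (Suc m) / fact r" "c (Suc r) = fact m / fact (Suc r)"
      "2 * real s - real r = real m + 1"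
      by (simp_all only: c_def m_def)
    show ?thesis unfolding eqs by (simp add: divide_simps) (simp add: algebra_simps)
  qed
  have z1: "X (Suc (2 * s)) i k = 0"
    unfolding X_def by (rule tensor_op_exhausted[OF assms])
  \<comment> \<open>for \<open>i = N\<close> the row \<open>Suc i\<close> lies outside the block, but it enters with the factor
    \<open>N - i = 0\<close>\<close>
  have z2: "anti_raise N (X (Suc (2 * s))) i k = 0"
    using tensor_op_exhausted[OF assms, of s] tensor_op_exhausted[of "Suc i" N s] assms
    unfolding X_def anti_raise_def raise_left_def raise_right_def
    by (cases "i = N") (auto split: nat.split simp del: tensor_op.simps)
  have squares:
    "(real N - real i)\<^sup>2 * coupling N s (Suc i) k = (\<Sum>r\<le>2*s. c r * (raise_left N (X r) i k)\<^sup>2)"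
    "(real i)\<^sup>2 * coupling N s (i - 1) k = (\<Sum>r\<le>2*s. c r * (lower_left (X r) i k)\<^sup>2)"
    "(real k + 1)\<^sup>2 * coupling N s i (Suc k) = (\<Sum>r\<le>2*s. c r * (lower_right (X r) i k)\<^sup>2)"
    "(case k of 0 \<Rightarrow> 0 | Suc l \<Rightarrow> (real N - real l)\<^sup>2 * coupling N s i l)
      = (\<Sum>r\<le>2*s. c r * (raise_right N (X r) i k)\<^sup>2)"
    unfolding coupling_def X_def[symmetric] c_def[symmetric]
    by (simp_all add: ladder_defs sum_distrib_left power_mult_distrib mult_ac add.commute
        split: nat.split)
  have "(real N - real i)\<^sup>2 * coupling N s (Suc i) k + (real i)\<^sup>2 * coupling N s (i - 1) k
       - (real k + 1)\<^sup>2 * coupling N s i (Suc k)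
       - (case k of 0 \<Rightarrow> 0 | Suc l \<Rightarrow> (real N - real l)\<^sup>2 * coupling N s i l)
     = (\<Sum>r\<le>2*s. c r * ((lower_left (X r) i k)\<^sup>2 - (lower_right (X r) i k)\<^sup>2))
       + (\<Sum>r\<le>2*s. c r * ((raise_left N (X r) i k)\<^sup>2 - (raise_right N (X r) i k)\<^sup>2))"
    unfolding squares by (simp add: right_diff_distrib sum_subtractf)
  also have "(\<Sum>r\<le>2*s. c r * ((lower_left (X r) i k)\<^sup>2 - (lower_right (X r) i k)\<^sup>2))
      = (\<Sum>r\<le>2*s. c r * X (Suc r) i k * anti_lower (X r) i k)"
    by (simp add: Xs ad_lower_def anti_lower_def power2_eq_square algebra_simps)
  also have "\<dots> = (\<Sum>r<2*s. c r * X (Suc r) i k * anti_lower (X r) i k)"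
    using z1 by (simp add: lessThan_Suc_atMost[symmetric])
  also have "\<dots> = (\<Sum>r<2*s. c (Suc r) * X (Suc r) i k * anti_lower (ad_raise N (X (Suc r))) i k)"
  proof (intro sum.cong refl)
    fix r assume "r \<in> {..<2*s}"
    then have c: "c r = c (Suc r) * ((real r + 1) * (2 * real s - real r))"
      using cs by simp
    show "c r * X (Suc r) i k * anti_lower (X r) i k
        = c (Suc r) * X (Suc r) i k * anti_lower (ad_raise N (X (Suc r))) i k"
      unfolding Xe ladder_scale c by (simp only: mult_ac)
  qed
  also have "\<dots> = (\<Sum>r\<le>2*s. c r * X r i k * anti_lower (ad_raise N (X r)) i k)"
    unfolding lessThan_Suc_atMost[symmetric]
    by (subst sum.lessThan_Suc_shift) (simp add: Xe(1) ladder_defs)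
  also have "(\<Sum>r\<le>2*s. c r * ((raise_left N (X r) i k)\<^sup>2 - (raise_right N (X r) i k)\<^sup>2))
      = (\<Sum>r\<le>2*s. c r * ad_raise N (X r) i k * anti_raise N (X r) i k)"
    by (simp add: ad_raise_def anti_raise_def power2_eq_square algebra_simps)
  also have "\<dots> = (\<Sum>r<2*s. c (Suc r) * ad_raise N (X (Suc r)) i k * anti_raise N (X (Suc r)) i k)"
    unfolding lessThan_Suc_atMost[symmetric]
    by (subst sum.lessThan_Suc_shift) (simp add: Xe(1))
  also have "\<dots> = (\<Sum>r<2*s. c r * X r i k * anti_raise N (ad_lower (X r)) i k)"
    by (intro sum.cong refl) (simp add: Xe Xs[symmetric] cs[symmetric] mult_ac)
  also have "\<dots> = (\<Sum>r\<le>2*s. c r * X r i k * anti_raise N (ad_lower (X r)) i k)"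
    using z2 by (simp add: lessThan_Suc_atMost[symmetric] Xs)
  also have "(\<Sum>r\<le>2*s. c r * X r i k * anti_lower (ad_raise N (X r)) i k) + \<dots>
      = (\<Sum>r\<le>2*s. c r * X r i k * (D * X r i k))"
    unfolding sum.distrib[symmetric] D_def anti_casimir[symmetric]
    by (simp add: distrib_left)
  also have "\<dots> = D * coupling N s i k"
    unfolding coupling_def X_def[symmetric] c_def[symmetric]
    by (simp add: sum_distrib_left power2_eq_square mult_ac)
  finally show ?thesis unfolding D_def .
qed

text \<open>
  The action of \<open>-[E, [F, X]]\<close> on diagonal matrices \<open>X\<close>. It does not depend on \<open>f (Suc N)\<close> at
  \<open>i = N\<close>, nor on the truncated predecessor at \<open>i = 0\<close>.
\<close>

definition laplacian :: "nat \<Rightarrow> (nat \<Rightarrow> real) \<Rightarrow> nat \<Rightarrow> real" where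
  "laplacian N f i = (real i + 1) * (real N - real i) * (f (Suc i) - f i)
                   + real i * (real N - real i + 1) * (f (i - 1) - f i)"

text \<open>
  The Laplacian acts on the row index on the left and on the column index on the right; it is
  symmetric, so this says that the two matrices commute. The binomial weights turn both rates of
  the Laplacian into the squares that occur in \<open>coupling_intertwine\<close>.
\<close>

lemma transition_kernel_laplacian_commute:
  assumes i: "i \<le> N" and k: "k \<le> N"
  shows "laplacian N (\<lambda>i. transition_kernel N s i k) i = laplacian N (transition_kernel N s i) k"
proof -
  define A where "A = coupling N s"
  define g where "g j = real (N choose j)" for j
  have step: "(real j + 1) * g (Suc j) = (real N - real j) * g j" if "j \<le> N" for j
  proof -
    have "Suc j * (N choose Suc j) = (N - j) * (N choose j)"
      using binomial_absorb_comp[of N j] binomial_absorption[of j N] by (metis mult.commute)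
    then have "real (Suc j) * g (Suc j) = real (N - j) * g j"
      unfolding g_def by (metis of_nat_mult)
    then show ?thesis using that by (simp add: of_nat_diff add.commute)
  qed
  have gpos: "g j > 0" if "j \<le> N" for j using that by (simp add: g_def)
  have up_i: "(real i + 1) * (real N - real i) * g (Suc i) = (real N - real i)\<^sup>2 * g i"
    using step[OF i] by (simp add: power2_eq_square mult_ac)
  have down_i: "real i * (real N - real i + 1) * g (i - 1) = (real i)\<^sup>2 * g i"
  proof (cases i)
    case (Suc l)
    then have "(real l + 1) * g i = (real N - real l) * g l" using step[of l] i by simp
    then have "(real l + 1) * ((real N - real l) * g l) = (real l + 1) * ((real l + 1) * g i)"
      by simp
    then show ?thesis using Suc by (simp add: power2_eq_square algebra_simps)
  qed simp
  \<comment> \<open>at \<open>k = N\<close> the quotient is \<open>0 / 0\<close>, and both sides are \<open>0\<close>\<close>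
  have up_k: "(real k + 1) * (real N - real k) * (A i (Suc k) / g (Suc k))
      = (real k + 1)\<^sup>2 * A i (Suc k) / g k"
  proof (cases "k = N")
    case True
    then have "A i (Suc k) = 0"
      using i unfolding A_def coupling_def by (simp add: tensor_op_outside)
    then show ?thesis by simp
  next
    case False
    with k have "g (Suc k) > 0" "g k > 0" by (auto intro!: gpos)
    then have ratio: "(real N - real k) / g (Suc k) = (real k + 1) / g k"
      using step[OF k] by (simp add: divide_simps mult.commute)
    have "(real k + 1) * (real N - real k) * (A i (Suc k) / g (Suc k))
        = (real k + 1) * A i (Suc k) * ((real N - real k) / g (Suc k))"
      by simp
    then show ?thesis unfolding ratio by (simp add: power2_eq_square)
  qed
  have down_k: "real k * (real N - real k + 1) * (A i (k - 1) / g (k - 1))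
      = (case k of 0 \<Rightarrow> 0 | Suc l \<Rightarrow> (real N - real l)\<^sup>2 * A i l) / g k"
  proof (cases k)
    case (Suc l)
    with k have "g l > 0" "g (Suc l) > 0" by (auto intro!: gpos)
    then have ratio: "(real l + 1) / g l = (real N - real l) / g (Suc l)"
      using step[of l] k Suc by (simp add: divide_simps mult.commute)
    have "real k * (real N - real k + 1) * (A i (k - 1) / g (k - 1))
        = (real N - real l) * A i l * ((real l + 1) / g l)"
      using Suc by simp
    then show ?thesis unfolding ratio using Suc by (simp add: power2_eq_square)
  qed simp
  define D where "D = (real i + 1) * (real N - real i) + real i * (real N - real i + 1)
        - (real k + 1) * (real N - real k) - real k * (real N - real k + 1)"
  have "laplacian N (\<lambda>i. transition_kernel N s i k) i - laplacian N (transition_kernel N s i) k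
    = ((real i + 1) * (real N - real i) * g (Suc i)) * A (Suc i) k / g k
      + (real i * (real N - real i + 1) * g (i - 1)) * A (i - 1) k / g k
      - g i * ((real k + 1) * (real N - real k) * (A i (Suc k) / g (Suc k)))
      - g i * (real k * (real N - real k + 1) * (A i (k - 1) / g (k - 1)))
      - D * A i k * g i / g k"
    unfolding laplacian_def transition_kernel_def A_def[symmetric] g_def[symmetric]
D_def
    by (simp add: algebra_simps diff_divide_distrib add_divide_distrib)
  also have "\<dots> = g i / g k * (((real N - real i)\<^sup>2 * A (Suc i) k + (real i)\<^sup>2 * A (i - 1) k
       - (real k + 1)\<^sup>2 * A i (Suc k)
       - (case k of 0 \<Rightarrow> 0 | Suc l \<Rightarrow> (real N - real l)\<^sup>2 * A i l))
     - D * A i k)"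
    unfolding up_i down_i up_k down_k
    by (simp add: right_diff_distrib distrib_left mult_ac)
  also have "\<dots> = 0"
    using coupling_intertwine[OF i, of s k] unfolding A_def D_def by simp
  finally show ?thesis by simp
qed

text \<open>
  Discrete Green's identity; the boundary term vanishes for \<open>M = N\<close>.
\<close>

lemma laplacian_green:
  "(\<Sum>k\<le>M. u k * laplacian N f k - f k * laplacian N u k)
     = (real M + 1) * (real N - real M) * (u M * f (Suc M) - f M * u (Suc M))"
  by (induction M) (simp_all add: laplacian_def algebra_simps)

lemma laplacian_symmetric:
  "(\<Sum>k\<le>N. u k * laplacian N f k) = (\<Sum>k\<le>N. f k * laplacian N u k)"
  using laplacian_green[of u N f N] by (simp add: sum_subtractf)

text \<open>
  The eigenvalue equation is a three-term recurrence. Its leading coefficient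
  \<open>(i + 1)(N - i)\<close> is nonzero for \<open>i < N\<close>, and at \<open>i = 0\<close> it involves only \<open>u 0\<close> and \<open>u 1\<close>.
\<close>

lemma laplacian_eigenvector_unique:
  assumes u: "\<And>i. i < N \<Longrightarrow> laplacian N u i = c * u i"
    and f: "\<And>i. i < N \<Longrightarrow> laplacian N f i = c * f i"
    and "f 0 = 1"
  shows "i \<le> N \<Longrightarrow> u i = u 0 * f i"
proof (induction i rule: less_induct)
  case (less i)
  show ?case
  proof (cases i)
    case 0
    then show ?thesis using \<open>f 0 = 1\<close> by simp
  next
    case (Suc j)
    define p where "p = (real j + 1) * (real N - real j)"
    define q where "q = real j * (real N - real j + 1)"
    have p: "p > 0" unfolding p_def using less.prems Suc by simp
    have IH: "u j = u 0 * f j" "u (j - 1) = u 0 * f (j - 1)"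
      using less.IH[of j] less.IH[of "j - 1"] less.prems Suc by auto
    have "p * (u (Suc j) - u j) + q * (u (j - 1) - u j) = c * u j"
      "p * (f (Suc j) - f j) + q * (f (j - 1) - f j) = c * f j"
      using u[of j] f[of j] less.prems Suc by (auto simp: laplacian_def p_def q_def)
    then have "p * u (Suc j) = p * (u 0 * f (Suc j))"
      unfolding IH by algebra
    then show ?thesis using p Suc by simp
  qed
qed

lemma transition_kernel_eigenvector:
  assumes f: "\<And>k. k \<le> N \<Longrightarrow> laplacian N f k = c * f k" and "f 0 = 1" and i: "i \<le> N"
  shows "(\<Sum>k\<le>N. transition_kernel N s i k * f k) = (\<Sum>k\<le>N. transition_kernel N s 0 k * f k) * f i"
proof -
  define u where "u i = (\<Sum>k\<le>N. transition_kernel N s i k * f k)" for i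
  \<comment> \<open>\<open>u\<close> is an eigenvector for the same eigenvalue, because kernel and Laplacian commute\<close>
  have "laplacian N u j = c * u j" if "j < N" for j
  proof -
    have "laplacian N u j = (\<Sum>k\<le>N. laplacian N (\<lambda>i. transition_kernel N s i k) j * f k)"
      by (simp add: laplacian_def u_def sum_distrib_left sum.distrib sum_subtractf algebra_simps)
    also have "\<dots> = (\<Sum>k\<le>N. f k * laplacian N (transition_kernel N s j) k)"
      using that by (intro sum.cong refl) (simp add: transition_kernel_laplacian_commute)
    also have "\<dots> = (\<Sum>k\<le>N. transition_kernel N s j k * (c * f k))"
      unfolding laplacian_symmetric[of f] by (intro sum.cong refl) (simp add: f)
    finally show ?thesis by (simp add: u_def sum_distrib_left mult_ac)
  qed
  from laplacian_eigenvector_unique[of N u c f, OF this _ \<open>f 0 = 1\<close> i] f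
  show ?thesis by (simp add: u_def)
qed

text \<open>
  The maximum principle: at a point where \<open>\<bar>f\<bar>\<close> is maximal, the eigenvalue equation of the
  kernel bounds the eigenvalue by the row sum. The case of a constant eigenvector shows that all
  row sums equal that of row \<open>0\<close>.
\<close>

lemma transition_kernel_eigenvalue_le:
  assumes f: "\<And>k. k \<le> N \<Longrightarrow> laplacian N f k = c * f k" and f0: "f 0 = 1"
  shows "\<bar>\<Sum>k\<le>N. transition_kernel N s 0 k * f k\<bar> \<le> (\<Sum>k\<le>N. transition_kernel N s 0 k)"
proof -
  define m where "m = Max ((\<lambda>k. \<bar>f k\<bar>) ` {..N})"
  have le: "\<bar>f k\<bar> \<le> m" if "k \<le> N" for k
    unfolding m_def using that by (intro Max_ge) auto
  have "m > 0" using le[of 0] f0 by simp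
  have "m \<in> (\<lambda>k. \<bar>f k\<bar>) ` {..N}" unfolding m_def by (intro Max_in) auto
  then obtain i where i: "i \<le> N" "\<bar>f i\<bar> = m" by auto
  have "(\<Sum>k\<le>N. transition_kernel N s i k) = (\<Sum>k\<le>N. transition_kernel N s 0 k)"
    using transition_kernel_eigenvector[of N "\<lambda>_. 1" 0 i s] i by (simp add: laplacian_def)
  moreover have "\<bar>\<Sum>k\<le>N. transition_kernel N s 0 k * f k\<bar> * m = \<bar>\<Sum>k\<le>N. transition_kernel N s i k * f k\<bar>"
    using transition_kernel_eigenvector[OF f f0 i(1), of s] i by (simp add: abs_mult)
  moreover have "\<dots> \<le> (\<Sum>k\<le>N. transition_kernel N s i k * m)"
    by (rule order_trans[OF sum_abs sum_mono])
      (auto simp: abs_mult transition_kernel_nonneg intro!: mult_left_mono le)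
  ultimately have "\<bar>\<Sum>k\<le>N. transition_kernel N s 0 k * f k\<bar> * m \<le> (\<Sum>k\<le>N. transition_kernel N s 0 k) * m"
    by (simp add: sum_distrib_right[symmetric])
  then show ?thesis using \<open>m > 0\<close> by simp
qed

section \<open>Discrete Chebyshev polynomials\<close>

definition chebyshev_coeff :: "nat \<Rightarrow> nat \<Rightarrow> nat \<Rightarrow> real" where
  "chebyshev_coeff N n j =
     pochhammer (- real n) j * pochhammer (real n + 1) j / ((fact j)\<^sup>2 * pochhammer (- real N) j)"

text \<open>
  The series \<open>3F2(-n, n+1, -k; 1, -N | 1)\<close>.
\<close>

definition discrete_chebyshev :: "nat \<Rightarrow> nat \<Rightarrow> nat \<Rightarrow> real" where
  "discrete_chebyshev N n k = (\<Sum>j\<le>n. chebyshev_coeff N n j * pochhammer (- real k) j)"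

text \<open>
  On the basis \<open>(-k)\<^sub>j\<close> the Laplacian is triangular with only two bands, so that its
  eigenvectors are hypergeometric.
\<close>

lemma laplacian_pochhammer_Suc:
  "laplacian N (\<lambda>k. pochhammer (- real k) (Suc j)) k
     = - (real j + 1) * (real j + 2) * pochhammer (- real k) (Suc j)
       - (real j + 1)\<^sup>2 * (real N - real j) * pochhammer (- real k) j"
proof -
  define w where "w = pochhammer (- real k) j"
  have now: "pochhammer (- real k) (Suc j) = w * (real j - real k)"
    by (simp add: w_def pochhammer_Suc)
  have up: "pochhammer (- real (Suc k)) (Suc j) = - (real k + 1) * w"
    by (simp add: pochhammer_rec w_def)
  have down: "real k * pochhammer (- real (k - 1)) (Suc j)
      = - w * (real j - real k) * (real j - real k + 1)"
  proof (cases k)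
    case 0
    then show ?thesis by (cases j) (simp_all add: w_def pochhammer_rec)
  next
    case (Suc l)
    have "pochhammer (- real k) (Suc (Suc j)) = - real k * pochhammer (- real l) (Suc j)"
      unfolding pochhammer_rec[of _ "Suc j"] using Suc by simp
    moreover have "pochhammer (- real k) (Suc (Suc j)) = w * (real j - real k) * (real j - real k + 1)"
      by (simp add: pochhammer_Suc w_def algebra_simps)
    ultimately show ?thesis using Suc by (simp add: algebra_simps)
  qed
  have "laplacian N (\<lambda>k. pochhammer (- real k) (Suc j)) k
    = (real k + 1) * (real N - real k) * (pochhammer (- real (Suc k)) (Suc j) - w * (real j - real k))
      + (real N - real k + 1) * (real k * pochhammer (- real (k - 1)) (Suc j)
          - real k * (w * (real j - real k)))"
    by (simp only: laplacian_def now) (simp add: algebra_simps)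
  also have "\<dots> = - (real j + 1) * (real j + 2) * (w * (real j - real k))
       - (real j + 1)\<^sup>2 * (real N - real j) * w"
    unfolding up down by (simp add: algebra_simps power2_eq_square)
  finally show ?thesis unfolding now w_def .
qed

text \<open>
  Comparing coefficients of \<open>(-k)\<^sub>j\<close> in the eigenvalue equation gives a first-order recurrence
  in \<open>j\<close>, which is the quotient of consecutive hypergeometric terms. The assumption \<open>n \<le> N\<close>
  keeps the denominators \<open>(-N)\<^sub>j\<close> with \<open>j \<le> n\<close> away from zero.
\<close>

lemma discrete_chebyshev_eigenvector:
  assumes "n \<le> N"
  shows "laplacian N (discrete_chebyshev N n) k = - (real n * (real n + 1)) * discrete_chebyshev N n k"
proof -
  define c where "c = chebyshev_coeff N n"
  define \<phi> where "\<phi> j = (\<lambda>k. pochhammer (- real k) j)" for j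
  have cs: "c (Suc j) * ((real j + 1)\<^sup>2 * (real N - real j))
      = - (real j - real n) * (real n + 1 + real j) * c j" if "j < n" for j
  proof -
    have nz: "pochhammer (- real N) j \<noteq> 0" "real j - real N \<noteq> 0"
      using that assms by (auto simp: pochhammer_of_nat_eq_0_iff)
    show ?thesis
      using nz by (simp add: c_def chebyshev_coeff_def pochhammer_Suc divide_simps)
        (simp add: algebra_simps power2_eq_square)
  qed
  have "laplacian N (discrete_chebyshev N n) k = (\<Sum>j\<le>n. c j * laplacian N (\<phi> j) k)"
    by (simp add: laplacian_def discrete_chebyshev_def c_def[symmetric] \<phi>_def sum_distrib_left
        sum.distrib sum_subtractf algebra_simps)
  also have "\<dots> = (\<Sum>j<n. c (Suc j) * laplacian N (\<phi> (Suc j)) k)"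
    unfolding lessThan_Suc_atMost[symmetric]
    by (subst sum.lessThan_Suc_shift) (simp add: \<phi>_def laplacian_def)
  also have "\<dots> = (\<Sum>j<n. - (real (Suc j) * (real (Suc j) + 1)) * c (Suc j) * \<phi> (Suc j) k)
      + (\<Sum>j<n. (real j - real n) * (real n + 1 + real j) * c j * \<phi> j k)"
    unfolding sum.distrib[symmetric]
  proof (intro sum.cong refl)
    fix j assume "j \<in> {..<n}"
    then have "c (Suc j) * ((real j + 1)\<^sup>2 * (real N - real j)) * \<phi> j k
       = - (real j - real n) * (real n + 1 + real j) * c j * \<phi> j k"
      using cs by simp
    then show "c (Suc j) * laplacian N (\<phi> (Suc j)) k =
         - (real (Suc j) * (real (Suc j) + 1)) * c (Suc j) * \<phi> (Suc j) k +
         (real j - real n) * (real n + 1 + real j) * c j * \<phi> j k"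
      unfolding \<phi>_def laplacian_pochhammer_Suc by (simp add: algebra_simps)
  qed
  also have "(\<Sum>j<n. - (real (Suc j) * (real (Suc j) + 1)) * c (Suc j) * \<phi> (Suc j) k)
      = (\<Sum>j\<le>n. - (real j * (real j + 1)) * c j * \<phi> j k)"
    unfolding lessThan_Suc_atMost[symmetric] by (subst sum.lessThan_Suc_shift) simp
  also have "(\<Sum>j<n. (real j - real n) * (real n + 1 + real j) * c j * \<phi> j k)
      = (\<Sum>j\<le>n. (real j - real n) * (real n + 1 + real j) * c j * \<phi> j k)"
    unfolding lessThan_Suc_atMost[symmetric] by simp
  also have "(\<Sum>j\<le>n. - (real j * (real j + 1)) * c j * \<phi> j k) + \<dots>
      = - (real n * (real n + 1)) * (\<Sum>j\<le>n. c j * \<phi> j k)"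
    unfolding sum.distrib[symmetric] sum_distrib_left
    by (intro sum.cong refl) (simp add: algebra_simps)
  finally show ?thesis by (simp add: discrete_chebyshev_def[of N n k] c_def \<phi>_def)
qed

lemma discrete_chebyshev_0: "discrete_chebyshev N n 0 = 1"
proof -
  have "discrete_chebyshev N n 0 = (\<Sum>j\<le>n. if j = 0 then 1 else 0)"
    unfolding discrete_chebyshev_def
    by (intro sum.cong refl) (auto simp: chebyshev_coeff_def pochhammer_0_left)
  then show ?thesis by simp
qed

section \<open>The Racah polynomial as an eigenvalue\<close>

text \<open>
  In row \<open>0\<close> the commutator with \<open>F\<close> has a single term, since row \<open>0\<close> of \<open>F\<close> is zero. Hence
  the entries of that row are products.
\<close>

lemma tensor_op_row_0:
  "k + r = s \<Longrightarrow> tensor_op N s r 0 k = (-1) ^ r * (fact s / fact k) * (\<Prod>l<s. real N - real l)"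
proof (induction r arbitrary: k)
  case (Suc r)
  define t where "t = tensor_op N s r 0 (Suc k)"
  have "tensor_op N s (Suc r) 0 k = - (real (Suc k) * t)"
    by (simp add: ladder_defs t_def)
  moreover have "t = (-1) ^ r * (fact s / fact (Suc k)) * (\<Prod>l<s. real N - real l)"
    unfolding t_def using Suc.prems by (intro Suc.IH) simp
  then have "real (Suc k) * t = (-1) ^ r * (fact s / fact k) * (\<Prod>l<s. real N - real l)"
    by (simp add: divide_simps mult_ac)
  ultimately show ?case by (simp only: power_Suc)
qed simp

lemma coupling_row_0:
  "coupling N s 0 k = (if k \<le> s then fact (s + k) / fact (s - k)
      * (fact s / fact k * (\<Prod>l<s. real N - real l))\<^sup>2 else 0)"
proof (cases "k \<le> s")
  case True
  have "coupling N s 0 k = (\<Sum>r\<le>2*s. if r = s - k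
      then fact (2 * s - r) / fact r * (tensor_op N s r 0 k)\<^sup>2 else 0)"
    unfolding coupling_def using True
    by (intro sum.cong refl) (auto simp: tensor_op_support)
  also have "\<dots> = fact (s + k) / fact (s - k) * (tensor_op N s (s - k) 0 k)\<^sup>2"
    using True by simp
  moreover have "((-1) ^ (s - k))\<^sup>2 = (1::real)"
    by (cases "even (s - k)") simp_all
  ultimately show ?thesis
    using True tensor_op_row_0[of k "s - k" s N]
    by (simp add: power_mult_distrib power_divide)
next
  case False
  then show ?thesis by (simp add: coupling_def tensor_op_support)
qed

lemma transition_kernel_row_0:
  assumes "s \<le> N"
  obtains C where "C > 0"
    and "\<And>k. k \<le> s \<Longrightarrow> transition_kernel N s 0 k
           = C * (fact (s + k) * fact (N - k) / (fact (s - k) * fact k))"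
    and "\<And>k. s < k \<Longrightarrow> transition_kernel N s 0 k = 0"
proof
  define P where "P = (\<Prod>l<s. real N - real l)"
  have "P > 0" unfolding P_def using assms by (intro prod_pos) auto
  then show "(fact s * P)\<^sup>2 / fact N > 0" by simp
  show "transition_kernel N s 0 k
      = (fact s * P)\<^sup>2 / fact N * (fact (s + k) * fact (N - k) / (fact (s - k) * fact k))"
    if "k \<le> s" for k
    using that assms
    by (simp add: transition_kernel_def coupling_row_0 P_def[symmetric] binomial_fact
        power2_eq_square field_simps)
  show "transition_kernel N s 0 k = 0" if "s < k" for k
    using that by (simp add: transition_kernel_def coupling_row_0)
qed

lemma pochhammer_minus_nat:
  "j \<le> k \<Longrightarrow> pochhammer (- real k) j = (-1) ^ j * (fact k / fact (k - j))"
proof (induction j)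
  case (Suc j)
  then have "k - j = Suc (k - Suc j)" "real k - real j = real (k - Suc j) + 1"
    by (auto simp: of_nat_diff)
  then show ?case
    using Suc by (simp add: pochhammer_Suc field_simps)
qed simp

lemma fact_add_pochhammer: "fact (a + l) = fact a * pochhammer (real a + 1) l"
  unfolding pochhammer_fact by (subst pochhammer_product') (simp add: add.commute)

text \<open>
  The terms with \<open>k < j\<close> vanish. After the shift \<open>k = l + j\<close>, the sum is an instance of the
  Chu-Vandermonde identity with parameters \<open>s + j + 1\<close> and \<open>N - s + 1\<close>.
\<close>

lemma row_0_moment:
  assumes "j \<le> s" "s \<le> N"
  shows "(\<Sum>k\<le>s. fact (s + k) * fact (N - k) / (fact (s - k) * fact k) * pochhammer (- real k) j)
     = (-1) ^ j * (fact (s + j) * fact (N - s) * fact (N + s + 1) / (fact (s - j) * fact (N + j + 1)))"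
    (is "(\<Sum>k\<le>s. ?g k) = _")
proof -
  define m where "m = s - j"
  define a where "a = real (s + j) + 1"
  define b where "b = real (N - s) + 1"
  have "(\<Sum>k\<le>s. ?g k) = (\<Sum>k\<in>{j..s}. ?g k)"
    by (intro sum.mono_neutral_right) (auto simp: pochhammer_of_nat_eq_0_iff)
  also have "\<dots> = (\<Sum>l\<le>m. ?g (l + j))"
    using assms sum.shift_bounds_cl_nat_ivl[of ?g 0 j m]
    by (simp add: m_def atLeast0AtMost)
  also have "\<dots> = (\<Sum>l\<le>m. (-1) ^ j * fact (s + j) * fact (N - s) / fact m
      * (of_nat (m choose l) * pochhammer a l * pochhammer b (m - l)))"
  proof (intro sum.cong refl)
    fix l assume "l \<in> {..m}"
    then have l: "l \<le> m" by simp
    have e: "s + (l + j) = (s + j) + l" "N - (l + j) = (N - s) + (m - l)" "s - (l + j) = m - l"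
      using l assms by (auto simp: m_def)
    have p: "pochhammer (- real (l + j)) j = (-1) ^ j * (fact (l + j) / fact l)"
      using pochhammer_minus_nat[of j "l + j"] by (simp del: of_nat_add)
    show "?g (l + j) = (-1) ^ j * fact (s + j) * fact (N - s) / fact m
      * (of_nat (m choose l) * pochhammer a l * pochhammer b (m - l))"
      unfolding p e fact_add_pochhammer[of "s + j" l] fact_add_pochhammer[of "N - s" "m - l"]
        a_def[symmetric] b_def[symmetric] binomial_fact[OF l]
      by (simp add: field_simps)
  qed
  also have "\<dots> = (-1) ^ j * fact (s + j) * fact (N - s) / fact m * pochhammer (a + b) m"
    by (simp add: pochhammer_binomial_sum sum_distrib_left)
  also have "pochhammer (a + b) m = fact (N + s + 1) / fact (N + j + 1)"
    using fact_add_pochhammer[of "N + j + 1" m] assms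
    by (simp add: m_def a_def b_def of_nat_diff add_ac)
  finally show ?thesis by (simp add: m_def)
qed

lemma transition_kernel_moment:
  assumes "s \<le> N"
  shows "(\<Sum>k\<le>N. transition_kernel N s 0 k * pochhammer (- real k) j)
    = (\<Sum>k\<le>N. transition_kernel N s 0 k)
      * (pochhammer (- real s) j * pochhammer (real s + 1) j / pochhammer (real N + 2) j)"
proof -
  obtain C where C: "\<And>k. k \<le> s \<Longrightarrow> transition_kernel N s 0 k
           = C * (fact (s + k) * fact (N - k) / (fact (s - k) * fact k))"
    "\<And>k. s < k \<Longrightarrow> transition_kernel N s 0 k = 0"
    using transition_kernel_row_0[OF assms] by metis
  have cut: "(\<Sum>k\<le>N. transition_kernel N s 0 k * f k)
     = C * (\<Sum>k\<le>s. fact (s + k) * fact (N - k) / (fact (s - k) * fact k) * f k)" for f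
  proof -
    have "(\<Sum>k\<le>N. transition_kernel N s 0 k * f k) = (\<Sum>k\<le>s. transition_kernel N s 0 k * f k)"
      using assms by (intro sum.mono_neutral_right) (auto simp: C(2))
    then show ?thesis by (simp add: C(1) sum_distrib_left mult.assoc)
  qed
  show ?thesis
  proof (cases "j \<le> s")
    case True
    have total: "(\<Sum>k\<le>N. transition_kernel N s 0 k)
        = C * (fact (N - s) * fact (N + s + 1) / fact (N + 1))"
      using cut[of "\<lambda>_. 1"] row_0_moment[of 0 s N] assms by simp
    have "fact (N + j + 1) = fact (N + 1) * pochhammer (real N + 2) j"
      using fact_add_pochhammer[of "N + 1" j] by (simp add: add_ac)
    moreover have "pochhammer (real N + 2) j > 0" by (simp add: pochhammer_pos)
    ultimately show ?thesis
      unfolding cut row_0_moment[OF True assms] total pochhammer_minus_nat[OF True]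
        fact_add_pochhammer[of s j]
      by (simp add: field_simps)
  next
    case False
    then have "pochhammer (- real k) j = 0" if "k \<le> s" for k
      using that by (simp add: pochhammer_of_nat_eq_0_iff)
    then show ?thesis unfolding cut by simp
  qed
qed

text \<open>
  The \<open>j\<close>-th moment of row \<open>0\<close> supplies the factors \<open>(-s)\<^sub>j (s+1)\<^sub>j / (1+T)\<^sub>j\<close> that turn the
  \<open>3F2\<close> series of the discrete Chebyshev polynomial into the \<open>4F3\<close> series of the Racah
  polynomial.
\<close>

lemma transition_kernel_chebyshev:
  assumes "s \<le> N"
  shows "(\<Sum>k\<le>N. transition_kernel N s 0 k * discrete_chebyshev N n k)
    = racah n s (Suc N) * (\<Sum>k\<le>N. transition_kernel N s 0 k)"
proof -
  define \<rho> where "\<rho> = (\<Sum>k\<le>N. transition_kernel N s 0 k)"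
  define t where "t j = (pochhammer (- real n) j * pochhammer (real n + 1) j *
         pochhammer (- real s) j * pochhammer (real s + 1) j) /
        ((fact j)\<^sup>2 * pochhammer (1 + real (Suc N)) j * pochhammer (1 - real (Suc N)) j)" for j
  have "(\<Sum>k\<le>N. transition_kernel N s 0 k * discrete_chebyshev N n k)
     = (\<Sum>k\<le>N. \<Sum>j\<le>n. transition_kernel N s 0 k * (chebyshev_coeff N n j * pochhammer (- real k) j))"
    by (simp add: discrete_chebyshev_def sum_distrib_left)
  also have "\<dots> = (\<Sum>j\<le>n. \<Sum>k\<le>N. transition_kernel N s 0 k * (chebyshev_coeff N n j * pochhammer (- real k) j))"
    by (rule sum.swap)
  also have "\<dots> = (\<Sum>j\<le>n. chebyshev_coeff N n j *
      (\<Sum>k\<le>N. transition_kernel N s 0 k * pochhammer (- real k) j))"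
    by (simp add: sum_distrib_left mult_ac)
  also have "\<dots> = (\<Sum>j\<le>n. \<rho> * t j)"
    unfolding transition_kernel_moment[OF assms] \<rho>_def[symmetric]
    by (intro sum.cong refl) (simp add: chebyshev_coeff_def t_def add_ac mult_ac)
  also have "\<dots> = \<rho> * (\<Sum>j\<le>n. t j)" by (simp add: sum_distrib_left)
  also have "(\<Sum>j\<le>n. t j) = (\<Sum>j=0..min n s. t j)"
    by (intro sum.mono_neutral_right) (auto simp: t_def pochhammer_of_nat_eq_0_iff)
  finally show ?thesis by (simp add: racah_def t_def \<rho>_def)
qed

section \<open>The bound and the inequality for weighted sums\<close>

theorem abs_racah_le_1:
  assumes "n < T" "s < T"
  shows "\<bar>racah n s T\<bar> \<le> 1"
proof -
  obtain N where T: "T = Suc N" and n: "n \<le> N" and s: "s \<le> N"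
    using assms by (cases T) auto
  define \<rho> where "\<rho> = (\<Sum>k\<le>N. transition_kernel N s 0 k)"
  have "transition_kernel N s 0 0 > 0"
    using transition_kernel_row_0[OF s] by (metis fact_gt_zero mult_pos_pos divide_pos_pos le0)
  then have "\<rho> > 0"
    unfolding \<rho>_def by (intro sum_pos2[of _ 0]) (auto simp: transition_kernel_nonneg)
  moreover have "\<bar>racah n s T * \<rho>\<bar> \<le> \<rho>"
    using transition_kernel_eigenvalue_le[OF discrete_chebyshev_eigenvector[OF n] discrete_chebyshev_0, of s]
    unfolding transition_kernel_chebyshev[OF s] T \<rho>_def .
  ultimately show ?thesis by (simp add: abs_mult)
qed

lemma racah_0: "racah 0 s T = 1"
  by (simp add: racah_def)

lemma racah_1_less_1:
  assumes "1 \<le> n" "T \<ge> 2"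
  shows "racah n 1 T < 1"
proof -
  have "min n 1 = 1" using assms by simp
  then have "racah n 1 T = 1 + 2 * real n * (real n + 1) / ((1 + real T) * (1 - real T))"
    by (simp add: racah_def algebra_simps)
  moreover have "2 * real n * (real n + 1) / ((1 + real T) * (1 - real T)) < 0"
    using assms by (intro divide_pos_neg mult_pos_pos mult_pos_neg) auto
  ultimately show ?thesis by simp
qed

theorem theorem3:
  fixes H :: "nat \<Rightarrow> real" and n T :: nat
  assumes "concave_increasing H"
    and "n \<le> T - 1" and "T \<ge> 3"
  shows "(\<Sum>s=1..T-1. (-1) ^ (s + 1) * racah n s T * H s) < (\<Sum>s=1..T-1. H s)"
proof (rule sum_strict_mono_ex1)
  have H: "H s > 0" if "s \<ge> 1" for s
    using assms(1) that unfolding concave_increasing_def by (auto intro!: sum_pos)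
  show "\<forall>s\<in>{1..T-1}. (-1) ^ (s + 1) * racah n s T * H s \<le> H s"
  proof
    fix s assume s: "s \<in> {1..T-1}"
    have "(-1) ^ (s + 1) * racah n s T \<le> \<bar>racah n s T\<bar>"
      by (cases "even s") auto
    also have "\<dots> \<le> 1" using s assms by (intro abs_racah_le_1) auto
    finally have "(-1) ^ (s + 1) * racah n s T \<le> 1" .
    from mult_right_mono[OF this, of "H s"]
    show "(-1) ^ (s + 1) * racah n s T * H s \<le> H s"
      using H[of s] s by simp
  qed
  show "\<exists>s\<in>{1..T-1}. (-1) ^ (s + 1) * racah n s T * H s < H s"
  proof (cases "n = 0")
    case True
    then show ?thesis
      using H[of 2] assms by (intro bexI[of _ 2]) (auto simp: racah_0)
  next
    case False
    then show ?thesis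
      using H[of 1] racah_1_less_1[of n T] assms by (intro bexI[of _ 1]) auto
  qed
qed simp

end
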